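(* Let $\boldsymbol Y\in\mathbb{R}^{d_Y}$ and $\boldsymbol Z\in\mathbb{R}^{d_Z}$ be random vectors on a common probability space, and let $$T^{\mathrm{AC}}(\boldsymbol Y,\boldsymbol Z):=\frac{\int \mathrm{var}(\mathbb{P}(\boldsymbol Y\ge \boldsymbol y\mid \boldsymbol Z))\,d\tilde\mu_{\boldsymbol Y}(\boldsymbol y)}{\int \mathrm{var}(\mathbb{1}\{\boldsymbol Y\ge \boldsymbol y\})\,d\tilde\mu_{\boldsymbol Y}(\boldsymbol y)}.$$ Suppose that $\boldsymbol Y$ is not almost surely a constant. Then: (i) $T^{\mathrm{AC}}(\boldsymbol Y,\boldsymbol Z)\in[0,1]$; (ii) $T^{\mathrm{AC}}(\boldsymbol Y,\boldsymbol Z)=0$ if and only if $\boldsymbol Y$ and $\boldsymbol Z$ are independent; (iii) $T^{\mathrm{AC}}(\boldsymbol Y,\boldsymbol Z)=1$ if and only if $\boldsymbol Y$ is almost surely a function of $\boldsymbol Z$.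
   Context: For vectors $\boldsymbol a,\boldsymbol b\in\mathbb{R}^d$, $\boldsymbol a\le\boldsymbol b$ (equivalently $\boldsymbol b\ge\boldsymbol a$) means $\boldsymbol a_i\le \boldsymbol b_i$ for all $i$. $\tilde\mu_{\boldsymbol Y}$ denotes the probability measure on $\mathbb{R}^{d_Y}$ which is the product of the one-dimensional marginal distributions of the coordinates of $\boldsymbol Y$ (each coordinate has the same marginal law as under the law of $\boldsymbol Y$, but the coordinates are independent). *)

theory Defs
  imports "HOL-Probability.Probability"
begin

definition sigma_gen :: "'a measure \<Rightarrow> ('a \<Rightarrow> 'b::topological_space) \<Rightarrow> 'a measure" where
  "sigma_gen M X = vimage_algebra (space M) X borel"

text \<open>
  The library's \<open>indep_var\<close> forces both variables to have the same value type, so independence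
  of two random vectors of different dimensions is stated for the generated sigma-algebras.
\<close>

definition independent_rvs ::
  "'a measure \<Rightarrow> ('a \<Rightarrow> 'b::topological_space) \<Rightarrow> ('a \<Rightarrow> 'c::topological_space) \<Rightarrow> bool" where
  "independent_rvs M X Z \<longleftrightarrow> prob_space.indep_set M (sets (sigma_gen M X)) (sets (sigma_gen M Z))"

text \<open>The relation \<open>\<le>\<close> on \<open>real ^ 'n\<close> is the componentwise order.\<close>

definition survival_indicator :: "('a \<Rightarrow> real ^ 'n) \<Rightarrow> real ^ 'n \<Rightarrow> 'a \<Rightarrow> real" where
  "survival_indicator Y y = indicator {\<omega>. y \<le> Y \<omega>}"

definition cond_survival ::
  "'a measure \<Rightarrow> ('a \<Rightarrow> real ^ 'n) \<Rightarrow> ('a \<Rightarrow> real ^ 'm) \<Rightarrow> real ^ 'n \<Rightarrow> 'a \<Rightarrow> real" where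
  "cond_survival M Y Z y = real_cond_exp M (sigma_gen M Z) (survival_indicator Y y)"

text \<open>
  The product of the marginal laws lives on functions \<open>'n \<Rightarrow> real\<close>; it is transported
  to \<open>real ^ 'n\<close> along the canonical bijection.
\<close>

definition prod_marginals :: "'a measure \<Rightarrow> ('a \<Rightarrow> real ^ 'n) \<Rightarrow> (real ^ 'n) measure" where
  "prod_marginals M Y =
     distr (\<Pi>\<^sub>M i\<in>UNIV. distr M borel (\<lambda>\<omega>. Y \<omega> $ i)) borel (\<lambda>x. \<chi> i. x i)"

definition T_AC :: "'a measure \<Rightarrow> ('a \<Rightarrow> real ^ 'n) \<Rightarrow> ('a \<Rightarrow> real ^ 'm) \<Rightarrow> real" where
  "T_AC M Y Z =
     (LINT y|prod_marginals M Y. prob_space.variance M (cond_survival M Y Z y)) /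
     (LINT y|prod_marginals M Y. prob_space.variance M (survival_indicator Y y))"

definition as_constant :: "'a measure \<Rightarrow> ('a \<Rightarrow> 'b) \<Rightarrow> bool" where
  "as_constant M Y \<longleftrightarrow> (\<exists>c. AE \<omega> in M. Y \<omega> = c)"

text \<open>
  The function is required to be Borel: for an arbitrary one the notion would be too weak, since
  on a suitable probability space a non-measurable function of \<open>Z\<close> can be a random variable
  independent of \<open>Z\<close>.
\<close>

definition as_function_of ::
  "'a measure \<Rightarrow> ('a \<Rightarrow> 'b::topological_space) \<Rightarrow> ('a \<Rightarrow> 'c::topological_space) \<Rightarrow> bool" where
  "as_function_of M Y Z \<longleftrightarrow> (\<exists>f\<in>borel_measurable borel. AE \<omega> in M. Y \<omega> = f (Z \<omega>))"

end

theory Submission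
  imports Defs
begin

text \<open>
  Write \<open>D y\<close> for the variance of the indicator of \<open>{y \<le> Y}\<close> and \<open>N y\<close> for the variance of its
  conditional expectation given \<open>Z\<close>. The coefficient is the quotient of the integrals of \<open>N\<close> and \<open>D\<close>
  against the product of the marginal laws of \<open>Y\<close>. By the law of total variance, \<open>D y - N y\<close> is the mean
  squared distance between the indicator and its conditional expectation
  (\<open>variance_minus_variance_cond_exp\<close>), so \<open>0 \<le> N \<le> D\<close>. Thus the coefficient lies between \<open>0\<close>
  and \<open>1\<close> once the denominator is positive, and its extreme values are attained exactly when \<open>N\<close> or
  \<open>D - N\<close> vanishes almost everywhere.

  The heart of the matter is to pass from almost every threshold to all of them, although the product of
  the marginals may be singular with respect to the joint law of \<open>Y\<close>. If \<open>s \<le> t\<close>, then each of \<open>N\<close>,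
  \<open>D\<close> and \<open>D - N\<close> changes between \<open>s\<close> and \<open>t\<close> by at most a constant times the probability that \<open>Y\<close>
  lies above \<open>s\<close> but not above \<open>t\<close> (\<open>dominated_by_survival\<close>). On the other hand, boxes with sides of
  positive marginal mass are not null sets for the product, and above any threshold \<open>t\<close> that \<open>Y\<close> reaches
  with positive probability there is such a box of points \<open>y\<close> for which \<open>{y \<le> Y}\<close> is almost as likely
  as \<open>{t \<le> Y}\<close> (\<open>AE_threshold_above\<close>). Hence a function of this kind that vanishes almost everywhere
  vanishes everywhere (\<open>dominated_by_survival_AE_zero\<close>). The same control makes the integrands
  left-continuous and therefore Borel (\<open>dominated_by_survival_measurable\<close>).

  It remains to interpret the vanishing for all thresholds. \<open>N = 0\<close> says that every event \<open>{t \<le> Y}\<close>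
  is independent of \<open>Z\<close>, and these events form a generating system that is closed under intersections.
  \<open>D - N = 0\<close> says that every event \<open>{t \<le> Y}\<close> is generated by \<open>Z\<close> up to a null set, and the rational
  thresholds then exhibit \<open>Y\<close> as a Borel function of \<open>Z\<close>. The latter argument with a constant in the
  place of \<open>Z\<close> shows that \<open>D = 0\<close> only if \<open>Y\<close> is almost surely constant; so the denominator is positive.
\<close>

section \<open>Thresholds that cut off little mass\<close>

text \<open>
  For the law \<open>N\<close> of one coordinate and a half-line \<open>U = {u..}\<close>, this produces points \<open>s \<ge> u\<close> that
  cut off little mass from \<open>U\<close>, enough of them to be seen by \<open>N\<close>, even if \<open>N\<close> has atoms or a gap to
  the right of \<open>u\<close>. The reason is that \<open>{s. N (U \<inter> {..<s}) < e}\<close> is a down-set, nonempty because the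
  mass tends to \<open>0\<close> at minus infinity. If it is not the whole line, it is \<open>{..q}\<close> or \<open>{..<q}\<close> for
  the point \<open>q\<close> at which the mass reaches \<open>e\<close>, so its intersection with \<open>U\<close> has mass at least \<open>e\<close>.
\<close>
lemma mass_below_small:
  fixes N :: "real measure"
  assumes "finite_measure N" and sets_N: "sets N = sets borel"
    and U: "U \<in> sets borel" and pos: "measure N U > 0" and e: "e > 0"
  defines "B \<equiv> {s \<in> U. measure N (U \<inter> {..<s}) < e}"
  shows "B \<in> sets borel" and "measure N B > 0"
proof -
  interpret finite_measure N by fact
  define g where "g s = measure N (U \<inter> {..<s})" for s
  have mono_g: "mono g"
    unfolding g_def mono_def using U by (auto intro!: finite_measure_mono simp: sets_N)
  have [measurable]: "g \<in> borel_measurable borel"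
    by (rule borel_measurable_mono[OF mono_g])
  have B_eq: "B = U \<inter> {s. g s < e}"
    by (auto simp: B_def g_def)
  show "B \<in> sets borel"
    unfolding B_eq using U by measurable
  show "measure N B > 0"
  proof (cases "\<forall>s. g s < e")
    case True
    then have "B = U" by (auto simp: B_eq)
    with pos show ?thesis by simp
  next
    case False
    then obtain b where b: "g b \<ge> e" by (auto simp: not_less)
    define S where "S = {s. g s < e}"
    have down: "s \<in> S" if "s' \<in> S" "s \<le> s'" for s s'
      using that monoD[OF mono_g, of s s'] by (auto simp: S_def)
    have "(\<lambda>n. measure N (U \<inter> {..<- real n})) \<longlonglongrightarrow> measure N (\<Inter>n. U \<inter> {..<- real n})"
      using U by (intro finite_Lim_measure_decseq) (auto simp: sets_N decseq_def)
    moreover have "(\<Inter>n. U \<inter> {..<- real n}) = {}"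
    proof -
      have "x \<notin> (\<Inter>n. U \<inter> {..<- real n})" for x
      proof -
        obtain n where "real n > - x" using reals_Archimedean2 by blast
        then show ?thesis by (auto intro!: exI[of _ n])
      qed
      then show ?thesis by blast
    qed
    ultimately have "(\<lambda>n. g (- real n)) \<longlonglongrightarrow> 0" by (simp add: g_def)
    then have "\<forall>\<^sub>F n in sequentially. g (- real n) < e"
      using e by (rule order_tendstoD)
    then obtain n where "- real n \<in> S"
      unfolding S_def by (auto simp: eventually_sequentially)
    then have ne: "S \<noteq> {}" by blast
    have bdd: "bdd_above S"
    proof (rule bdd_aboveI)
      fix s assume "s \<in> S"
      then show "s \<le> b" using b down[of s b] by (force simp: S_def)
    qed
    define q where "q = Sup S"
    have le_q: "s \<le> q" if "s \<in> S" for s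
      unfolding q_def using that bdd by (rule cSup_upper)
    have less_q: "s \<in> S" if "s < q" for s
      using that down less_cSup_iff[OF ne bdd, of s] by (auto simp: q_def)
    show ?thesis
    proof (cases "q \<in> S")
      case True
      \<comment> \<open>The mass of \<open>U \<inter> {..<s}\<close> is at least \<open>e\<close> for all \<open>s > q\<close>; letting \<open>s\<close> decrease to \<open>q\<close>
        gives the closed half-line.\<close>
      have "B = U \<inter> {..q}"
        using True le_q down unfolding B_eq S_def[symmetric] by auto
      also have "\<dots> = (\<Inter>n. U \<inter> {..<q + 1 / real (Suc n)})"
      proof -
        have "x \<le> q" if "\<forall>n. x < q + 1 / real (Suc n)" for x
        proof (rule ccontr)
          assume "\<not> x \<le> q"
          then obtain n where "1 / real (Suc n) < x - q"
            using reals_Archimedean[of "x - q"] by (auto simp: inverse_eq_divide)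
          with that show False by (smt (verit))
        qed
        moreover have "x < q + 1 / real (Suc n)" if "x \<le> q" for x n
          by (rule le_less_trans[OF that]) simp
        ultimately show ?thesis by blast
      qed
      finally have B_lim: "B = (\<Inter>n. U \<inter> {..<q + 1 / real (Suc n)})" .
      have "(\<lambda>n. g (q + 1 / real (Suc n))) \<longlonglongrightarrow> measure N B"
        unfolding g_def B_lim
      proof (rule finite_Lim_measure_decseq)
        show "decseq (\<lambda>n. U \<inter> {..<q + 1 / real (Suc n)})"
          by (auto simp: decseq_def intro: less_le_trans frac_le)
            (smt (verit) frac_le of_nat_0_le_iff of_nat_mono)
      qed (use U in \<open>auto simp: sets_N\<close>)
      moreover have "g (q + 1 / real (Suc n)) \<ge> e" for n
      proof -
        have "\<not> q + 1 / real (Suc n) \<le> q" by simp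
        then show ?thesis using le_q[of "q + 1 / real (Suc n)"] unfolding S_def by force
      qed
      ultimately have "measure N B \<ge> e"
        by (intro LIMSEQ_le_const) auto
      with e show ?thesis by simp
    next
      case False
      then have "B = U \<inter> {..<q}"
        using le_q less_q unfolding B_eq S_def[symmetric] by (auto simp: less_le)
      moreover have "g q \<ge> e" using False by (simp add: S_def)
      ultimately show ?thesis using e by (simp add: g_def)
    qed
  qed
qed

definition survival :: "'a measure \<Rightarrow> ('a \<Rightarrow> real ^ 'n) \<Rightarrow> real ^ 'n \<Rightarrow> real" where
  "survival M Y y = measure M {\<omega> \<in> space M. y \<le> Y \<omega>}"

lemma vec_lambda_measurable [measurable (raw)]:
  assumes "\<And>i. (\<lambda>x. f x i) \<in> borel_measurable N"
  shows "(\<lambda>x. (\<chi> i. f x i) :: real ^ 'n) \<in> borel_measurable N"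
  using assms by (subst borel_measurable_euclidean_space) (auto simp: Basis_vec_def inner_axis)

lemma vec_nth_measurable [measurable (raw)]:
  "Y \<in> borel_measurable N \<Longrightarrow> (\<lambda>\<omega>. (Y \<omega> :: real ^ 'n) $ i) \<in> borel_measurable N"
  by (rule measurable_compose[OF _ borel_measurable_nth])

lemma upper_orthant_measurable [measurable]:
  fixes Y :: "'a \<Rightarrow> real ^ 'n"
  assumes [measurable]: "Y \<in> borel_measurable M"
  shows "Measurable.pred M (\<lambda>\<omega>. y \<le> Y \<omega>)"
  unfolding less_eq_vec_def by measurable

lemma (in prob_space) prob_space_prod_marginals:
  fixes Y :: "'a \<Rightarrow> real ^ 'n"
  assumes [measurable]: "Y \<in> borel_measurable M"
  shows "prob_space (prod_marginals M Y)"
proof -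
  have "prob_space (distr M borel (\<lambda>\<omega>. Y \<omega> $ i))" for i
    by (rule prob_space_distr) measurable
  then have "prob_space (\<Pi>\<^sub>M i\<in>UNIV. distr M borel (\<lambda>\<omega>. Y \<omega> $ i))"
    by (rule prob_space_PiM)
  then show ?thesis
    unfolding prod_marginals_def by (rule prob_space.prob_space_distr) measurable
qed

lemma sets_prod_marginals [measurable_cong, simp]: "sets (prod_marginals M Y) = sets borel"
  by (simp add: prod_marginals_def)

text \<open>
  Here the product structure enters: a box whose sides have positive marginal mass has positive
  measure, being a product of finitely many positive numbers. The joint law of \<open>Y\<close> may well give
  measure \<open>0\<close> to such a box.
\<close>
lemma (in prob_space) AE_prod_marginals_meets_box:
  fixes Y :: "'a \<Rightarrow> real ^ 'n"
  assumes Y [measurable]: "Y \<in> borel_measurable M"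
    and B [measurable]: "\<And>i. B i \<in> sets borel"
    and pos: "\<And>i. measure (distr M borel (\<lambda>\<omega>. Y \<omega> $ i)) (B i) > 0"
    and AE: "AE y in prod_marginals M Y. P y"
  obtains y where "P y" and "\<And>i. y $ i \<in> B i"
proof -
  let ?N = "\<lambda>i. distr M borel (\<lambda>\<omega>. Y \<omega> $ i)"
  interpret N: prob_space "?N i" for i
    by (rule prob_space_distr) measurable
  interpret product_prob_space ?N UNIV
    by unfold_locales
  let ?Q = "{y. \<forall>i. y $ i \<in> B i}"
  have [measurable]: "?Q \<in> sets borel" by measurable
  have "emeasure (prod_marginals M Y) ?Q
      = emeasure (\<Pi>\<^sub>M i\<in>UNIV. ?N i) ((\<lambda>x. \<chi> i. x i) -` ?Q \<inter> space (\<Pi>\<^sub>M i\<in>UNIV. ?N i))"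
    unfolding prod_marginals_def by (rule emeasure_distr) measurable
  also have "(\<lambda>x. \<chi> i. x i) -` ?Q \<inter> space (\<Pi>\<^sub>M i\<in>UNIV. ?N i) = Pi\<^sub>E UNIV B"
    by (auto simp: space_PiM PiE_def Pi_def)
  also have "emeasure (\<Pi>\<^sub>M i\<in>UNIV. ?N i) (Pi\<^sub>E UNIV B) = (\<Prod>i\<in>UNIV. emeasure (?N i) (B i))"
    by (rule emeasure_PiM) auto
  also have "\<dots> \<noteq> 0"
    using pos by (auto simp: N.emeasure_eq_measure less_le)
  finally have "emeasure (prod_marginals M Y) ?Q \<noteq> 0" .
  moreover have "emeasure (prod_marginals M Y) ?Q = 0" if "\<forall>y\<in>?Q. \<not> P y"
  proof -
    have "AE y in prod_marginals M Y. y \<notin> ?Q"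
      using AE by eventually_elim (use that in blast)
    then show ?thesis
      by (subst (asm) AE_iff_measurable[OF _ refl]) (auto simp: prod_marginals_def)
  qed
  ultimately obtain y where "y \<in> ?Q" "P y" by blast
  then show ?thesis by (intro that) auto
qed

lemma (in prob_space) survival_diff:
  fixes Y :: "'a \<Rightarrow> real ^ 'n"
  assumes [measurable]: "Y \<in> borel_measurable M" and "s \<le> t"
  shows "survival M Y s - survival M Y t = prob {\<omega> \<in> space M. s \<le> Y \<omega> \<and> \<not> t \<le> Y \<omega>}"
proof -
  have "survival M Y s - survival M Y t
      = prob ({\<omega> \<in> space M. s \<le> Y \<omega>} - {\<omega> \<in> space M. t \<le> Y \<omega>})"
    unfolding survival_def using \<open>s \<le> t\<close> by (subst finite_measure_Diff) auto
  also have "{\<omega> \<in> space M. s \<le> Y \<omega>} - {\<omega> \<in> space M. t \<le> Y \<omega>}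
      = {\<omega> \<in> space M. s \<le> Y \<omega> \<and> \<not> t \<le> Y \<omega>}" by auto
  finally show ?thesis .
qed

text \<open>
  The thresholds at which an almost sure property holds approximate every threshold \<open>t\<close> of positive
  survival probability, in the sense that matters here: the event \<open>{y \<le> Y}\<close> is close to
  \<open>{t \<le> Y}\<close> in probability. Each coordinate \<open>y $ i\<close> is taken from the set of positive marginal
  mass on which \<open>{t $ i \<le> Y $ i < y $ i}\<close> is unlikely, and these events cover the difference.
\<close>
lemma (in prob_space) AE_threshold_above:
  fixes Y :: "'a \<Rightarrow> real ^ 'n"
  assumes Y [measurable]: "Y \<in> borel_measurable M"
    and AE: "AE y in prod_marginals M Y. P y"
    and t: "survival M Y t > 0" and e: "e > 0"
  obtains y where "t \<le> y" "P y" "survival M Y t - survival M Y y \<le> e"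
proof -
  let ?N = "\<lambda>i. distr M borel (\<lambda>\<omega>. Y \<omega> $ i)"
  define e' where "e' = e / real CARD('n)"
  have e': "e' > 0" using e by (simp add: e'_def)
  define B where "B i = {s \<in> {t $ i..}. measure (?N i) ({t $ i..} \<inter> {..<s}) < e'}" for i
  have N_eq: "measure (?N i) A = prob {\<omega> \<in> space M. Y \<omega> $ i \<in> A}" if "A \<in> sets borel" for i A
    using that by (subst measure_distr, measurable) (auto intro!: arg_cong[where f = prob])
  have "measure (?N i) {t $ i..} > 0" for i
  proof -
    have "survival M Y t \<le> prob {\<omega> \<in> space M. Y \<omega> $ i \<in> {t $ i..}}"
      unfolding survival_def by (intro finite_measure_mono) (auto simp: less_eq_vec_def)
    with t show ?thesis by (simp add: N_eq)
  qed
  then have B: "B i \<in> sets borel" "measure (?N i) (B i) > 0" for i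
    unfolding B_def using mass_below_small[OF _ _ _ _ e', of "?N i" "{t $ i..}"]
    by (simp_all add: finite_measure_distr)
  obtain y where y: "P y" "\<And>i. y $ i \<in> B i"
    using AE_prod_marginals_meets_box[OF Y B AE] by blast
  have ty: "t \<le> y" using y(2) by (auto simp: B_def less_eq_vec_def)
  have "survival M Y t - survival M Y y = prob {\<omega> \<in> space M. t \<le> Y \<omega> \<and> \<not> y \<le> Y \<omega>}"
    using ty by (rule survival_diff[OF Y])
  also have "\<dots> \<le> prob (\<Union>i. {\<omega> \<in> space M. Y \<omega> $ i \<in> {t $ i..} \<inter> {..<y $ i}})"
    by (intro finite_measure_mono) (auto simp: less_eq_vec_def not_le)
  also have "\<dots> \<le> (\<Sum>i\<in>UNIV. prob {\<omega> \<in> space M. Y \<omega> $ i \<in> {t $ i..} \<inter> {..<y $ i}})"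
    by (intro finite_measure_subadditive_finite) auto
  also have "\<dots> \<le> (\<Sum>i\<in>(UNIV::'n set). e')"
    using y(2) by (intro sum_mono) (auto simp: B_def N_eq less_imp_le)
  also have "\<dots> = e" by (simp add: e'_def)
  finally show ?thesis using that ty y(1) by blast
qed

text \<open>
  The indicators of \<open>{r n \<le> Y}\<close> converge pointwise: these events all contain \<open>{y \<le> Y}\<close>, and an
  outcome outside \<open>{y \<le> Y}\<close> violates some coordinate strictly, hence eventually violates it for
  \<open>r n\<close> as well.
\<close>
lemma (in prob_space) survival_left_continuous:
  fixes Y :: "'a \<Rightarrow> real ^ 'n"
  assumes [measurable]: "Y \<in> borel_measurable M"
    and le: "\<And>n. r n \<le> y" and lim: "r \<longlonglongrightarrow> y"
  shows "(\<lambda>n. survival M Y (r n)) \<longlonglongrightarrow> survival M Y y"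
proof -
  have eq: "survival M Y s = (\<integral>\<omega>. indicator {\<omega> \<in> space M. s \<le> Y \<omega>} \<omega> \<partial>M)" for s
    by (simp add: survival_def)
  show ?thesis
    unfolding eq
  proof (rule integral_dominated_convergence[where w = "\<lambda>_. 1"])
    show "AE \<omega> in M. (\<lambda>n. indicator {\<omega> \<in> space M. r n \<le> Y \<omega>} \<omega>)
        \<longlonglongrightarrow> (indicator {\<omega> \<in> space M. y \<le> Y \<omega>} \<omega> :: real)"
    proof (rule AE_I2)
      fix \<omega> assume \<omega>: "\<omega> \<in> space M"
      have "\<forall>\<^sub>F n in sequentially. r n \<le> Y \<omega> \<longleftrightarrow> y \<le> Y \<omega>"
      proof (cases "y \<le> Y \<omega>")
        case True
        then have "r n \<le> Y \<omega>" for n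
          using le[of n] by (rule order_trans[rotated])
        with True show ?thesis by simp
      next
        case False
        then obtain i where "Y \<omega> $ i < y $ i" by (auto simp: less_eq_vec_def not_le)
        then have "\<forall>\<^sub>F n in sequentially. Y \<omega> $ i < r n $ i"
          using tendsto_vec_nth[OF lim] by (intro order_tendstoD(1))
        then show ?thesis
          by eventually_elim (use False in \<open>meson less_eq_vec_def not_le\<close>)
      qed
      then show "(\<lambda>n. indicator {\<omega> \<in> space M. r n \<le> Y \<omega>} \<omega>)
          \<longlonglongrightarrow> (indicator {\<omega> \<in> space M. y \<le> Y \<omega>} \<omega> :: real)"
        by (intro tendsto_eventually, eventually_elim) (auto simp: indicator_def)
    qed
  qed (auto simp: indicator_def)
qed

section \<open>Functions of the threshold controlled by the survival function\<close>

text \<open>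
  The integrands of both variance integrals, and their difference, vary with the threshold no faster
  than the survival function, up to a constant. The second clause is the first with \<open>t\<close> at
  infinity; it gives the value \<open>0\<close> at the thresholds that \<open>Y\<close> almost surely does not reach, for which
  a good approximation from above may not exist.
\<close>
definition dominated_by_survival ::
  "'a measure \<Rightarrow> ('a \<Rightarrow> real ^ 'n) \<Rightarrow> (real ^ 'n \<Rightarrow> real) \<Rightarrow> bool" where
  "dominated_by_survival M Y h \<longleftrightarrow>
     (\<exists>K. (\<forall>s t. s \<le> t \<longrightarrow> \<bar>h s - h t\<bar> \<le> K * (survival M Y s - survival M Y t)) \<and>
          (\<forall>t. \<bar>h t\<bar> \<le> K * survival M Y t))"

lemma dominated_by_survival_diff:
  assumes "dominated_by_survival M Y g" and "dominated_by_survival M Y h"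
  shows "dominated_by_survival M Y (\<lambda>y. g y - h y)"
proof -
  obtain K L where K: "\<And>s t. s \<le> t \<Longrightarrow> \<bar>g s - g t\<bar> \<le> K * (survival M Y s - survival M Y t)"
      "\<And>t. \<bar>g t\<bar> \<le> K * survival M Y t"
    and L: "\<And>s t. s \<le> t \<Longrightarrow> \<bar>h s - h t\<bar> \<le> L * (survival M Y s - survival M Y t)"
      "\<And>t. \<bar>h t\<bar> \<le> L * survival M Y t"
    using assms unfolding dominated_by_survival_def by blast
  have "\<bar>(g s - h s) - (g t - h t)\<bar> \<le> (K + L) * (survival M Y s - survival M Y t)" if "s \<le> t" for s t
    using K(1)[OF that] L(1)[OF that] unfolding distrib_right by linarith
  moreover have "\<bar>g t - h t\<bar> \<le> (K + L) * survival M Y t" for t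
    using K(2)[of t] L(2)[of t] unfolding distrib_right by linarith
  ultimately show ?thesis unfolding dominated_by_survival_def by blast
qed

text \<open>
  Measurability of the integrands is not automatic; even a coordinatewise monotone function of
  several variables need not be Borel. But \<open>h\<close> inherits left-continuity from the survival function,
  and rounding \<open>y\<close> down to the grid of mesh \<open>1 / Suc n\<close> writes \<open>h\<close> as a limit of measurable
  functions with countably many values.
\<close>
lemma (in prob_space) dominated_by_survival_measurable:
  fixes Y :: "'a \<Rightarrow> real ^ 'n"
  assumes Y: "Y \<in> borel_measurable M" and h: "dominated_by_survival M Y h"
  shows "h \<in> borel_measurable borel"
proof -
  obtain K where K: "\<And>s t. s \<le> t \<Longrightarrow> \<bar>h s - h t\<bar> \<le> K * (survival M Y s - survival M Y t)"
    using h unfolding dominated_by_survival_def by blast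
  define k :: "nat \<Rightarrow> real ^ 'n \<Rightarrow> int ^ 'n" where "k n y = (\<chi> i. \<lfloor>real (Suc n) * y $ i\<rfloor>)" for n y
  define g :: "nat \<Rightarrow> int ^ 'n \<Rightarrow> real ^ 'n" where "g n a = (\<chi> i. of_int (a $ i) / real (Suc n))" for n a
  have g_le: "g n (k n y) \<le> y" for n y
    by (auto simp: less_eq_vec_def g_def k_def divide_le_eq mult.commute)
  have g_lim: "(\<lambda>n. g n (k n y)) \<longlonglongrightarrow> y" for y
  proof (rule vec_tendstoI, rule tendsto_sandwich)
    fix i
    show "(\<lambda>n. y $ i + - inverse (real (Suc n))) \<longlonglongrightarrow> y $ i"
      by (rule LIMSEQ_inverse_real_of_nat_add_minus)
    have "y $ i + - inverse (real (Suc n)) \<le> g n (k n y) $ i" for n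
    proof -
      have "real (Suc n) * y $ i - 1 \<le> of_int \<lfloor>real (Suc n) * y $ i\<rfloor>" by linarith
      then have "(real (Suc n) * y $ i - 1) / real (Suc n) \<le> g n (k n y) $ i"
        unfolding g_def k_def by (simp add: divide_right_mono del: of_nat_Suc)
      then show ?thesis by (simp add: diff_divide_distrib inverse_eq_divide del: of_nat_Suc)
    qed
    then show "\<forall>\<^sub>F n in sequentially. y $ i + - inverse (real (Suc n)) \<le> g n (k n y) $ i"
      by simp
    show "\<forall>\<^sub>F n in sequentially. g n (k n y) $ i \<le> y $ i"
      using g_le by (simp add: less_eq_vec_def)
  qed simp
  have h_lim: "(\<lambda>n. h (g n (k n y))) \<longlonglongrightarrow> h y" for y
  proof -
    have "(\<lambda>n. K * (survival M Y (g n (k n y)) - survival M Y y)) \<longlonglongrightarrow> K * (survival M Y y - survival M Y y)"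
      by (intro tendsto_intros survival_left_continuous Y g_le g_lim)
    then have null: "(\<lambda>n. K * (survival M Y (g n (k n y)) - survival M Y y)) \<longlonglongrightarrow> 0"
      by simp
    have "norm (h (g n (k n y)) - h y) \<le> K * (survival M Y (g n (k n y)) - survival M Y y)" for n
      using K[OF g_le] by simp
    then have "(\<lambda>n. h (g n (k n y)) - h y) \<longlonglongrightarrow> 0"
      using null by (rule Lim_null_comparison[OF always_eventually, OF allI])
    then show ?thesis by (rule LIM_zero_cancel)
  qed
  have k_meas: "k n \<in> measurable borel (count_space UNIV)" for n
  proof (subst measurable_count_space_eq2_countable, safe)
    fix a
    have "k n -` {a} \<inter> space borel = {y. \<forall>i. of_int (a $ i) \<le> real (Suc n) * y $ i \<and> real (Suc n) * y $ i < of_int (a $ i) + 1}"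
      by (auto simp: k_def vec_eq_iff floor_eq_iff)
    also have "\<dots> \<in> sets borel" by measurable
    finally show "k n -` {a} \<inter> space borel \<in> sets borel" .
  qed auto
  show ?thesis
  proof (rule borel_measurable_LIMSEQ_real[OF h_lim])
    fix n
    show "(\<lambda>y. h (g n (k n y))) \<in> borel_measurable borel"
      using k_meas by (rule measurable_compose) simp
  qed
qed

text \<open>
  This step turns statements about almost every threshold into statements about all of them.
  By the approximation of \<open>t\<close> by good thresholds \<open>y\<close>, the value \<open>h t\<close> differs from \<open>h y = 0\<close> by
  arbitrarily little.
\<close>
lemma (in prob_space)
  fixes Y :: "'a \<Rightarrow> real ^ 'n"
  assumes Y: "Y \<in> borel_measurable M" and h: "dominated_by_survival M Y h"
  shows dominated_by_survival_integrable: "integrable (prod_marginals M Y) h"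
    and dominated_by_survival_AE_zero: "AE y in prod_marginals M Y. h y = 0 \<Longrightarrow> h t = 0"
proof -
  obtain K where K: "\<And>s t. s \<le> t \<Longrightarrow> \<bar>h s - h t\<bar> \<le> K * (survival M Y s - survival M Y t)"
      "\<And>t. \<bar>h t\<bar> \<le> K * survival M Y t"
    using h unfolding dominated_by_survival_def by blast
  interpret \<mu>: prob_space "prod_marginals M Y"
    using Y by (rule prob_space_prod_marginals)
  have "\<bar>h y\<bar> \<le> \<bar>K\<bar>" for y
  proof -
    have "K * survival M Y y \<le> \<bar>K\<bar> * 1"
      by (intro mult_mono) (auto simp: survival_def)
    with K(2)[of y] show ?thesis by linarith
  qed
  then show "integrable (prod_marginals M Y) h"
    using dominated_by_survival_measurable[OF Y h]
    by (intro \<mu>.integrable_const_bound[where B = "\<bar>K\<bar>"]) auto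
  assume AE: "AE y in prod_marginals M Y. h y = 0"
  show "h t = 0"
  proof (cases "survival M Y t > 0")
    case False
    then have "survival M Y t = 0" by (simp add: survival_def measure_nonneg less_le)
    with K(2)[of t] show ?thesis by simp
  next
    case True
    have "\<bar>h t\<bar> \<le> 0 + e" if "e > 0" for e
    proof -
      define d where "d = e / (\<bar>K\<bar> + 1)"
      have d: "d > 0" using that by (simp add: d_def add_nonneg_pos)
      obtain y where y: "t \<le> y" "h y = 0" "survival M Y t - survival M Y y \<le> d"
        using AE_threshold_above[OF Y AE True d] .
      have nonneg: "0 \<le> survival M Y t - survival M Y y"
        unfolding survival_diff[OF Y y(1)] by simp
      have "\<bar>h t\<bar> \<le> K * (survival M Y t - survival M Y y)"
        using K(1)[OF y(1)] y(2) by simp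
      also have "\<dots> \<le> (\<bar>K\<bar> + 1) * d"
        using y(3) nonneg by (intro mult_mono) auto
      also have "\<dots> = e"
        by (simp add: d_def add_nonneg_pos less_imp_neq[symmetric])
      finally show ?thesis by simp
    qed
    then have "\<bar>h t\<bar> \<le> 0" by (rule field_le_epsilon)
    then show ?thesis by simp
  qed
qed

lemma (in prob_space) dominated_by_survival_integral_eq_0_iff:
  fixes Y :: "'a \<Rightarrow> real ^ 'n"
  assumes Y: "Y \<in> borel_measurable M" and h: "dominated_by_survival M Y h"
    and nonneg: "\<And>y. h y \<ge> 0"
  shows "(LINT y|prod_marginals M Y. h y) = 0 \<longleftrightarrow> (\<forall>t. h t = 0)"
proof
  assume "(LINT y|prod_marginals M Y. h y) = 0"
  then have "AE y in prod_marginals M Y. h y = 0"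
    using nonneg by (simp add: integral_nonneg_eq_0_iff_AE dominated_by_survival_integrable[OF Y h])
  then show "\<forall>t. h t = 0"
    using dominated_by_survival_AE_zero[OF Y h] by blast
qed simp

section \<open>Variances and conditional expectations\<close>

lemma (in prob_space) integrable_if_AE_in_unit_interval:
  fixes g :: "'a \<Rightarrow> real"
  assumes "g \<in> borel_measurable M" and "AE \<omega> in M. P \<omega>"
    and "\<And>\<omega>. P \<omega> \<Longrightarrow> 0 \<le> g \<omega>" "\<And>\<omega>. P \<omega> \<Longrightarrow> g \<omega> \<le> 1"
  shows "integrable M g"
proof (rule integrable_const_bound[where B = 1])
  show "AE \<omega> in M. norm (g \<omega>) \<le> 1"
    using assms(2) by eventually_elim (use assms(3,4) in force)
qed (rule assms(1))

text \<open>
  The variance is a difference of \<open>E[X\<^sup>2]\<close> and \<open>(E[X])\<^sup>2\<close>. Passing from \<open>W\<close> to \<open>U\<close> increases each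
  of the two by at most \<open>2 (E[U] - E[W])\<close>, because squaring is increasing and 2-Lipschitz on the
  unit interval; so their difference changes by no more than that.
\<close>
lemma (in prob_space) variance_diff_le:
  fixes U W :: "'a \<Rightarrow> real"
  assumes [measurable]: "U \<in> borel_measurable M" "W \<in> borel_measurable M"
    and W: "AE \<omega> in M. 0 \<le> W \<omega>" and WU: "AE \<omega> in M. W \<omega> \<le> U \<omega>" and U: "AE \<omega> in M. U \<omega> \<le> 1"
  shows "\<bar>variance U - variance W\<bar> \<le> 2 * (expectation U - expectation W)"
proof -
  have bounds: "AE \<omega> in M. 0 \<le> W \<omega> \<and> W \<omega> \<le> U \<omega> \<and> U \<omega> \<le> 1"
    using W WU U by eventually_elim simp
  have [simp]: "integrable M U" by (rule integrable_if_AE_in_unit_interval[OF _ bounds]) auto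
  have [simp]: "integrable M W" by (rule integrable_if_AE_in_unit_interval[OF _ bounds]) auto
  have [simp]: "integrable M (\<lambda>\<omega>. (U \<omega>)\<^sup>2)"
    by (rule integrable_if_AE_in_unit_interval[OF _ bounds]) (auto simp: power_le_one)
  have [simp]: "integrable M (\<lambda>\<omega>. (W \<omega>)\<^sup>2)"
    by (rule integrable_if_AE_in_unit_interval[OF _ bounds]) (auto simp: power_le_one)
  have sq: "0 \<le> a\<^sup>2 - b\<^sup>2 \<and> a\<^sup>2 - b\<^sup>2 \<le> 2 * (a - b)" if "0 \<le> b" "b \<le> a" "a \<le> 1" for a b :: real
  proof -
    have "a\<^sup>2 - b\<^sup>2 = (a + b) * (a - b)" by (simp add: power2_eq_square algebra_simps)
    moreover have "(a + b) * (a - b) \<le> 2 * (a - b)"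
      by (rule mult_right_mono) (use that in auto)
    moreover have "0 \<le> (a + b) * (a - b)"
      using that by simp
    ultimately show ?thesis by simp
  qed
  have means: "0 \<le> expectation W" "expectation W \<le> expectation U" "expectation U \<le> 1"
  proof -
    show "0 \<le> expectation W" using W by (rule integral_nonneg_AE)
    show "expectation W \<le> expectation U" using WU by (intro integral_mono_AE) auto
    have "expectation U \<le> expectation (\<lambda>_. 1)" using U by (intro integral_mono_AE) auto
    then show "expectation U \<le> 1" by (simp add: prob_space)
  qed
  have "expectation (\<lambda>\<omega>. (W \<omega>)\<^sup>2) \<le> expectation (\<lambda>\<omega>. (U \<omega>)\<^sup>2)"
    using bounds by (intro integral_mono_AE) (auto intro: power_mono)
  moreover have "expectation (\<lambda>\<omega>. (U \<omega>)\<^sup>2 - (W \<omega>)\<^sup>2) \<le> expectation (\<lambda>\<omega>. 2 * (U \<omega> - W \<omega>))"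
  proof (rule integral_mono_AE)
    show "AE \<omega> in M. (U \<omega>)\<^sup>2 - (W \<omega>)\<^sup>2 \<le> 2 * (U \<omega> - W \<omega>)"
      using bounds by eventually_elim (use sq in blast)
  qed auto
  ultimately show ?thesis
    using sq[OF means] by (simp add: variance_eq abs_le_iff)
qed

lemma (in prob_space) variance_eq_0_iff:
  fixes X :: "'a \<Rightarrow> real"
  assumes [measurable]: "X \<in> borel_measurable M" and bounded: "AE \<omega> in M. \<bar>X \<omega>\<bar> \<le> 1"
  shows "variance X = 0 \<longleftrightarrow> (AE \<omega> in M. X \<omega> = expectation X)"
proof -
  have "integrable M (\<lambda>\<omega>. (X \<omega> - expectation X)\<^sup>2)"
  proof (rule integrable_const_bound)
    show "AE \<omega> in M. norm ((X \<omega> - expectation X)\<^sup>2) \<le> (1 + \<bar>expectation X\<bar>)\<^sup>2"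
      using bounded by eventually_elim (auto simp: abs_le_square_iff[symmetric])
  qed measurable
  then show ?thesis by (subst integral_nonneg_eq_0_iff_AE) auto
qed

lemma (in prob_space) dominated_by_survival_variance:
  fixes Y :: "'a \<Rightarrow> real ^ 'n" and W :: "real ^ 'n \<Rightarrow> 'a \<Rightarrow> real"
  assumes Y: "Y \<in> borel_measurable M"
    and W: "\<And>y. W y \<in> borel_measurable M" "\<And>y. AE \<omega> in M. 0 \<le> W y \<omega>" "\<And>y. AE \<omega> in M. W y \<omega> \<le> 1"
    and mono: "\<And>s t. s \<le> t \<Longrightarrow> AE \<omega> in M. W t \<omega> \<le> W s \<omega>"
    and mean: "\<And>y. expectation (W y) = survival M Y y"
  shows "dominated_by_survival M Y (\<lambda>y. variance (W y))"
  unfolding dominated_by_survival_def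
proof (intro exI[of _ 2] conjI allI impI)
  show "\<bar>variance (W s) - variance (W t)\<bar> \<le> 2 * (survival M Y s - survival M Y t)" if "s \<le> t" for s t
    using variance_diff_le[OF W(1) W(1) W(2) mono[OF that] W(3)] by (simp add: mean)
  show "\<bar>variance (W t)\<bar> \<le> 2 * survival M Y t" for t
    using variance_diff_le[OF W(1)[of t], of "\<lambda>_. 0"] W(2,3)[of t] by (simp add: mean)
qed

lemma survival_indicator_eq: "survival_indicator Y y \<omega> = (if y \<le> Y \<omega> then 1 else 0)"
  by (simp add: survival_indicator_def indicator_def)

lemma survival_indicator_measurable [measurable]:
  fixes Y :: "'a \<Rightarrow> real ^ 'n"
  assumes [measurable]: "Y \<in> borel_measurable N"
  shows "survival_indicator Y y \<in> borel_measurable N"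
  unfolding survival_indicator_eq[abs_def] by measurable

lemma (in prob_space)
  fixes Y :: "'a \<Rightarrow> real ^ 'n"
  assumes [measurable]: "Y \<in> borel_measurable M"
  shows survival_indicator_integrable: "integrable M (survival_indicator Y y)"
    and expectation_survival_indicator: "expectation (survival_indicator Y y) = survival M Y y"
proof -
  show "integrable M (survival_indicator Y y)"
    by (rule integrable_if_AE_in_unit_interval[of _ "\<lambda>_. True"]) (auto simp: survival_indicator_eq)
  have "expectation (survival_indicator Y y) = expectation (indicator {\<omega> \<in> space M. y \<le> Y \<omega>})"
    by (intro Bochner_Integration.integral_cong) (auto simp: survival_indicator_eq indicator_def)
  then show "expectation (survival_indicator Y y) = survival M Y y"
    by (simp add: survival_def)
qed

lemma subalgebra_sigma_gen:
  assumes "Z \<in> borel_measurable M"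
  shows "subalgebra M (sigma_gen M Z)"
  using sets_image_in_sets[OF refl assms] by (simp add: subalgebra_def sigma_gen_def)

text \<open>
  This is Pythagoras in \<open>L\<^sup>2\<close>: the residual \<open>f - E[f | F]\<close> is orthogonal to \<open>E[f | F]\<close>. The
  difference of the variances is therefore nonnegative, and zero exactly if \<open>f\<close> is
  \<open>F\<close>-measurable up to a null set.
\<close>
lemma (in prob_space)
  assumes F: "subalgebra M F" and [measurable]: "f \<in> borel_measurable M"
    and f0: "AE \<omega> in M. 0 \<le> f \<omega>" and f1: "AE \<omega> in M. f \<omega> \<le> 1"
  shows variance_minus_variance_cond_exp:
      "variance f - variance (real_cond_exp M F f) = expectation (\<lambda>\<omega>. (f \<omega> - real_cond_exp M F f \<omega>)\<^sup>2)"
    and variance_eq_variance_cond_exp_iff: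
      "variance f = variance (real_cond_exp M F f) \<longleftrightarrow> (AE \<omega> in M. f \<omega> = real_cond_exp M F f \<omega>)"
proof -
  interpret finite_measure_subalgebra M F
    by unfold_locales (rule F)
  let ?E = "real_cond_exp M F f"
  have f_int [simp]: "integrable M f"
    by (rule integrable_if_AE_in_unit_interval[OF _ AE_conjI[OF f0 f1]]) auto
  have "AE \<omega> in M. 0 \<le> ?E \<omega>" "AE \<omega> in M. ?E \<omega> \<le> 1"
    using real_cond_exp_ge_c[OF f_int f0] real_cond_exp_le_c[OF f_int f1] by auto
  then have bounds: "AE \<omega> in M. 0 \<le> f \<omega> \<and> f \<omega> \<le> 1 \<and> 0 \<le> ?E \<omega> \<and> ?E \<omega> \<le> 1"
    using f0 f1 by eventually_elim simp
  have [simp]: "integrable M ?E" "expectation ?E = expectation f"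
    using real_cond_exp_int[OF f_int] by auto
  have [simp]: "integrable M (\<lambda>\<omega>. (f \<omega>)\<^sup>2)"
    by (rule integrable_if_AE_in_unit_interval[OF _ bounds]) (auto simp: power_le_one)
  have [simp]: "integrable M (\<lambda>\<omega>. (?E \<omega>)\<^sup>2)"
    by (rule integrable_if_AE_in_unit_interval[OF _ bounds]) (auto simp: power_le_one)
  have [simp]: "integrable M (\<lambda>\<omega>. ?E \<omega> * f \<omega>)"
    by (rule integrable_if_AE_in_unit_interval[OF _ bounds]) (auto simp: mult_le_one)
  have orth: "expectation (\<lambda>\<omega>. ?E \<omega> * f \<omega>) = expectation (\<lambda>\<omega>. (?E \<omega>)\<^sup>2)"
    using real_cond_exp_intg(2)[of ?E f] by (simp add: power2_eq_square)
  have "expectation (\<lambda>\<omega>. (f \<omega> - ?E \<omega>)\<^sup>2)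
      = expectation (\<lambda>\<omega>. (f \<omega>)\<^sup>2 - 2 * (?E \<omega> * f \<omega>) + (?E \<omega>)\<^sup>2)"
    by (intro Bochner_Integration.integral_cong) (auto simp: power2_diff algebra_simps)
  also have "\<dots> = expectation (\<lambda>\<omega>. (f \<omega>)\<^sup>2) - expectation (\<lambda>\<omega>. (?E \<omega>)\<^sup>2)"
    by (simp add: orth)
  also have "\<dots> = variance f - variance ?E"
    using variance_eq[of f] variance_eq[of ?E] by simp
  finally show eq: "variance f - variance ?E = expectation (\<lambda>\<omega>. (f \<omega> - ?E \<omega>)\<^sup>2)" ..
  have "integrable M (\<lambda>\<omega>. (f \<omega> - ?E \<omega>)\<^sup>2)"
    by (rule integrable_if_AE_in_unit_interval[OF _ bounds]) (auto simp: abs_square_le_1)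
  then show "variance f = variance ?E \<longleftrightarrow> (AE \<omega> in M. f \<omega> = ?E \<omega>)"
    using integral_nonneg_eq_0_iff_AE[of M "\<lambda>\<omega>. (f \<omega> - ?E \<omega>)\<^sup>2"] eq by auto
qed

section \<open>Upper orthants determine a random vector\<close>

lemma borel_eq_atLeast_vec: "borel = sigma UNIV (range (\<lambda>t :: real ^ 'n. {t..}))"
  (is "_ = ?SIGMA")
proof (rule borel_eq_sigmaI4[OF borel_eq_halfspace_ge])
  fix a :: real and b :: "real ^ 'n" assume "(a, b) \<in> UNIV \<times> Basis"
  then obtain j where b: "b = axis j 1" by (auto simp: Basis_vec_def)
  define t :: "nat \<Rightarrow> real ^ 'n" where "t k = (\<chi> i. if i = j then a else - real k)" for k
  have "\<exists>k. t k \<le> x" if "a \<le> x $ j" for x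
  proof -
    obtain k where k: "norm x \<le> real k" using real_arch_simple by blast
    have "- real k \<le> x $ i" for i
      using component_le_norm_cart[of x i] k by linarith
    with that have "t k \<le> x" by (simp add: t_def less_eq_vec_def)
    then show ?thesis ..
  qed
  moreover have "a \<le> x $ j" if "t k \<le> x" for k x
    using that by (auto simp: t_def less_eq_vec_def dest: spec[of _ j])
  ultimately have "{x. a \<le> x \<bullet> b} = (\<Union>k. {t k..})"
    by (auto simp: b inner_axis)
  also have "\<dots> \<in> sets ?SIGMA"
    by (intro sets.countable_UN) auto
  finally show "{x. a \<le> x \<bullet> b} \<in> sets ?SIGMA" .
qed auto

text \<open>
  Upper orthants are closed under intersection and generate the Borel sets, so independence need
  only be tested on them.
\<close>
lemma (in prob_space) independent_rvs_iff_orthants: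
  fixes Y :: "'a \<Rightarrow> real ^ 'n" and Z :: "'a \<Rightarrow> 'b::topological_space"
  assumes Y [measurable]: "Y \<in> borel_measurable M" and Z: "Z \<in> borel_measurable M"
  shows "independent_rvs M Y Z \<longleftrightarrow>
    (\<forall>t. \<forall>C\<in>sets (sigma_gen M Z). prob ({\<omega> \<in> space M. t \<le> Y \<omega>} \<inter> C) = survival M Y t * prob C)"
proof -
  define G where "G = {Y -` A \<inter> space M | A. A \<in> range (\<lambda>t. {t..})}"
  have G_eq: "G = range (\<lambda>t. {\<omega> \<in> space M. t \<le> Y \<omega>})"
    unfolding G_def by (auto intro!: image_eqI exI[of _ "{_..}"])
  have Y_gen: "sets (sigma_gen M Y) = sigma_sets (space M) G"
  proof -
    have "sigma_gen M Y = sigma (space M) G"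
      unfolding sigma_gen_def G_def borel_eq_atLeast_vec by (rule vimage_algebra_sigma) auto
    moreover have "G \<subseteq> Pow (space M)" by (auto simp: G_eq)
    ultimately show ?thesis by simp
  qed
  have Z_sub: "sets (sigma_gen M Z) \<subseteq> events" and Z_space: "space (sigma_gen M Z) = space M"
    using subalgebra_sigma_gen[OF Z] by (auto simp: subalgebra_def)
  show ?thesis
  proof
    assume "independent_rvs M Y Z"
    then have "indep_set (sets (sigma_gen M Y)) (sets (sigma_gen M Z))"
      by (simp add: independent_rvs_def)
    moreover have "{\<omega> \<in> space M. t \<le> Y \<omega>} \<in> sets (sigma_gen M Y)" for t
      unfolding Y_gen by (rule sigma_sets.Basic) (auto simp: G_eq)
    ultimately show "\<forall>t. \<forall>C\<in>sets (sigma_gen M Z).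
        prob ({\<omega> \<in> space M. t \<le> Y \<omega>} \<inter> C) = survival M Y t * prob C"
      unfolding survival_def by (blast intro: indep_setD)
  next
    assume *: "\<forall>t. \<forall>C\<in>sets (sigma_gen M Z).
        prob ({\<omega> \<in> space M. t \<le> Y \<omega>} \<inter> C) = survival M Y t * prob C"
    have "indep_set G (sets (sigma_gen M Z))"
      by (rule indep_setI) (use * Z_sub in \<open>auto simp: G_eq survival_def\<close>)
    moreover have "Int_stable G"
    proof -
      have "{\<omega> \<in> space M. s \<le> Y \<omega>} \<inter> {\<omega> \<in> space M. t \<le> Y \<omega>}
          = {\<omega> \<in> space M. (\<chi> i. max (s $ i) (t $ i)) \<le> Y \<omega>}" for s t
        by (auto simp: less_eq_vec_def)
      then show ?thesis unfolding Int_stable_def G_eq by blast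
    qed
    moreover have "Int_stable (sets (sigma_gen M Z))"
      by (auto simp: Int_stable_def)
    ultimately have "indep_set (sigma_sets (space M) G) (sigma_sets (space M) (sets (sigma_gen M Z)))"
      by (rule indep_set_sigma_sets)
    then show "independent_rvs M Y Z"
      using sets.sigma_sets_eq[of "sigma_gen M Z"]
      by (simp add: independent_rvs_def Y_gen Z_space)
  qed
qed

lemma ereal_SUP_rational_orthants:
  fixes y :: "real ^ 'n"
  shows "(SUP q :: rat ^ 'n. if (\<chi> j. of_rat (q $ j)) \<le> y then ereal (of_rat (q $ i)) else - \<infinity>)
       = ereal (y $ i)" (is "(SUP q. ?e q) = _")
proof (rule antisym)
  show "(SUP q. ?e q) \<le> ereal (y $ i)"
    by (rule SUP_least) (auto simp: less_eq_vec_def)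
  show "ereal (y $ i) \<le> (SUP q. ?e q)"
  proof (rule ccontr)
    assume "\<not> ereal (y $ i) \<le> (SUP q. ?e q)"
    then obtain r where r: "(SUP q. ?e q) < ereal r" "ereal r < ereal (y $ i)"
      using ereal_dense2[of "SUP q. ?e q" "ereal (y $ i)"] by (auto simp: not_le)
    have "\<forall>j. \<exists>p. of_rat p \<le> y $ j \<and> (j = i \<longrightarrow> r < of_rat p)"
    proof
      fix j
      obtain p where "(if j = i then r else y $ j - 1) < of_rat p" "of_rat p < y $ j"
        using of_rat_dense[of "if j = i then r else y $ j - 1" "y $ j"] r(2) by (cases "j = i") auto
      then show "\<exists>p. of_rat p \<le> y $ j \<and> (j = i \<longrightarrow> r < of_rat p)"
        by (intro exI[of _ p]) auto
    qed
    then obtain p where p: "\<And>j. of_rat (p j) \<le> y $ j" "r < of_rat (p i)" by metis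
    have "ereal r < ?e (\<chi> j. p j)"
      using p by (simp add: less_eq_vec_def)
    also have "\<dots> \<le> (SUP q. ?e q)" by (rule SUP_upper) simp
    finally show False using r(1) by simp
  qed
qed

text \<open>
  A vector is recovered from the rational orthants that contain it, its coordinate \<open>i\<close> being the
  supremum of the coordinates \<open>i\<close> of their corners. Only countably many null sets are discarded, and
  replacing each membership \<open>\<rho> q \<le> Y \<omega>\<close> by \<open>Z \<omega> \<in> A q\<close> in that supremum defines the Borel
  function. It is taken in the extended reals because it may be infinite at points that \<open>Z\<close>
  almost surely avoids.
\<close>
lemma as_function_of_if_orthants_determined:
  fixes Y :: "'a \<Rightarrow> real ^ 'n" and Z :: "'a \<Rightarrow> 'b::topological_space"
  assumes "\<And>t. \<exists>A\<in>sets borel. AE \<omega> in M. t \<le> Y \<omega> \<longleftrightarrow> Z \<omega> \<in> A"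
  shows "as_function_of M Y Z"
proof -
  define \<rho> :: "rat ^ 'n \<Rightarrow> real ^ 'n" where "\<rho> q = (\<chi> j. of_rat (q $ j))" for q
  have "\<forall>q. \<exists>A\<in>sets borel. AE \<omega> in M. \<rho> q \<le> Y \<omega> \<longleftrightarrow> Z \<omega> \<in> A"
    using assms by blast
  then obtain A where A [measurable]: "\<And>q. A q \<in> sets borel"
    and AE_A: "\<And>q. AE \<omega> in M. \<rho> q \<le> Y \<omega> \<longleftrightarrow> Z \<omega> \<in> A q"
    by metis
  define f :: "'b \<Rightarrow> real ^ 'n" where
    "f z = (\<chi> i. real_of_ereal (SUP q. if z \<in> A q then ereal (of_rat (q $ i)) else - \<infinity>))" for z
  have "f \<in> borel_measurable borel"
    unfolding f_def by measurable
  moreover have "AE \<omega> in M. Y \<omega> = f (Z \<omega>)"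
  proof -
    have "AE \<omega> in M. \<forall>q. \<rho> q \<le> Y \<omega> \<longleftrightarrow> Z \<omega> \<in> A q"
      using AE_A by (simp add: AE_all_countable)
    then show ?thesis
    proof eventually_elim
      case (elim \<omega>)
      have "f (Z \<omega>) $ i = Y \<omega> $ i" for i
        using ereal_SUP_rational_orthants[of "Y \<omega>" i] elim by (simp add: f_def \<rho>_def)
      then show ?case by (simp add: vec_eq_iff)
    qed
  qed
  ultimately show ?thesis unfolding as_function_of_def by blast
qed

text \<open>
  If no event \<open>{t \<le> Y}\<close> is random, then these events are determined by a constant variable, and \<open>Y\<close>
  is a function of that constant. The constants \<open>c t\<close> are \<open>0\<close> or \<open>1\<close>, as values of an indicator.
\<close>
lemma (in prob_space) as_constant_if_survival_indicators_constant:
  fixes Y :: "'a \<Rightarrow> real ^ 'n"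
  assumes "\<And>t. AE \<omega> in M. survival_indicator Y t \<omega> = c t"
  shows "as_constant M Y"
proof -
  have "as_function_of M Y (\<lambda>_. 0 :: real)"
  proof (rule as_function_of_if_orthants_determined)
    fix t
    have "AE \<omega> in M. t \<le> Y \<omega> \<longleftrightarrow> 0 \<in> (if c t = 1 then UNIV else {} :: real set)"
      using assms[of t] by eventually_elim (auto simp: survival_indicator_eq split: if_splits)
    then show "\<exists>A\<in>sets borel. AE \<omega> in M. t \<le> Y \<omega> \<longleftrightarrow> (0 :: real) \<in> A"
      by (intro bexI[of _ "if c t = 1 then UNIV else {}"]) auto
  qed
  then show ?thesis
    by (auto simp: as_function_of_def as_constant_def)
qed

section \<open>The two extreme cases\<close>

text \<open>
  The conditional probability of \<open>{t \<le> Y}\<close> has no variance if and only if it equals the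
  unconditional one. By the defining property of conditional expectation, this says that
  \<open>{t \<le> Y}\<close> is independent of every event generated by \<open>Z\<close>.
\<close>
lemma (in prob_space) variance_cond_survival_eq_0_iff:
  fixes Y :: "'a \<Rightarrow> real ^ 'n" and Z :: "'a \<Rightarrow> real ^ 'm"
  assumes Y [measurable]: "Y \<in> borel_measurable M" and Z: "Z \<in> borel_measurable M"
  shows "(\<forall>t. variance (cond_survival M Y Z t) = 0) \<longleftrightarrow> independent_rvs M Y Z"
proof -
  let ?F = "sigma_gen M Z"
  interpret finite_measure_subalgebra M ?F
    by unfold_locales (rule subalgebra_sigma_gen[OF Z])
  have ind: "integrable M (survival_indicator Y t)" for t
    using Y by (rule survival_indicator_integrable)
  have mean: "expectation (cond_survival M Y Z t) = survival M Y t" for t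
    unfolding cond_survival_def using real_cond_exp_int(2)[OF ind] Y
    by (simp add: expectation_survival_indicator)
  have "AE \<omega> in M. \<bar>cond_survival M Y Z t \<omega>\<bar> \<le> 1" for t
    using real_cond_exp_ge_c[OF ind, of 0 t] real_cond_exp_le_c[OF ind, of t 1]
    unfolding cond_survival_def by (auto simp: survival_indicator_eq)
  then have "variance (cond_survival M Y Z t) = 0
      \<longleftrightarrow> (AE \<omega> in M. cond_survival M Y Z t \<omega> = survival M Y t)" for t
    using variance_eq_0_iff[of "cond_survival M Y Z t"] by (simp add: mean) (simp add: cond_survival_def)
  also have "(AE \<omega> in M. cond_survival M Y Z t \<omega> = survival M Y t) \<longleftrightarrow>
      (\<forall>C\<in>sets ?F. prob ({\<omega> \<in> space M. t \<le> Y \<omega>} \<inter> C) = survival M Y t * prob C)" for t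
  proof -
    have F_sub: "C \<in> events" if "C \<in> sets ?F" for C
      using that subalg by (auto simp: subalgebra_def)
    have left: "(\<integral>\<omega>\<in>C. survival_indicator Y t \<omega> \<partial>M) = prob ({\<omega> \<in> space M. t \<le> Y \<omega>} \<inter> C)"
      if "C \<in> sets ?F" for C
    proof -
      have "(\<integral>\<omega>\<in>C. survival_indicator Y t \<omega> \<partial>M)
          = expectation (indicator ({\<omega> \<in> space M. t \<le> Y \<omega>} \<inter> C))"
        unfolding set_lebesgue_integral_def
        by (intro Bochner_Integration.integral_cong) (auto simp: survival_indicator_eq indicator_def)
      also have "\<dots> = prob ({\<omega> \<in> space M. t \<le> Y \<omega>} \<inter> C)"
        using F_sub[OF that] by simp
      finally show ?thesis .
    qed
    have right: "(\<integral>\<omega>\<in>C. survival M Y t \<partial>M) = survival M Y t * prob C" if "C \<in> sets ?F" for C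
      using F_sub[OF that] by (simp add: set_lebesgue_integral_def mult.commute)
    show ?thesis
    proof (intro iffI ballI)
      fix C assume AE: "AE \<omega> in M. cond_survival M Y Z t \<omega> = survival M Y t" and C: "C \<in> sets ?F"
      have [measurable]: "C \<in> events" using C by (rule F_sub)
      have "prob ({\<omega> \<in> space M. t \<le> Y \<omega>} \<inter> C) = (\<integral>\<omega>\<in>C. cond_survival M Y Z t \<omega> \<partial>M)"
        using real_cond_exp_intA[OF ind C] left[OF C] by (simp add: cond_survival_def)
      also have "\<dots> = (\<integral>\<omega>\<in>C. survival M Y t \<partial>M)"
        unfolding set_lebesgue_integral_def
      proof (rule integral_cong_AE)
        show "AE \<omega> in M. indicat_real C \<omega> *\<^sub>R cond_survival M Y Z t \<omega> = indicat_real C \<omega> *\<^sub>R survival M Y t"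
          using AE by eventually_elim simp
      qed (simp_all add: cond_survival_def)
      finally show "prob ({\<omega> \<in> space M. t \<le> Y \<omega>} \<inter> C) = survival M Y t * prob C"
        using right[OF C] by simp
    next
      assume *: "\<forall>C\<in>sets ?F. prob ({\<omega> \<in> space M. t \<le> Y \<omega>} \<inter> C) = survival M Y t * prob C"
      show "AE \<omega> in M. cond_survival M Y Z t \<omega> = survival M Y t"
        unfolding cond_survival_def
        by (rule real_cond_exp_charact) (use * left right ind in auto)
    qed
  qed
  finally show ?thesis
    by (simp add: independent_rvs_iff_orthants[OF Y Z])
qed

text \<open>
  An indicator that agrees almost surely with its conditional expectation is the indicator of an
  event generated by \<open>Z\<close>, namely of the set where the conditional expectation equals \<open>1\<close>.
\<close>
lemma (in prob_space) survival_indicator_eq_cond_survival_iff: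
  fixes Y :: "'a \<Rightarrow> real ^ 'n" and Z :: "'a \<Rightarrow> real ^ 'm"
  assumes Y [measurable]: "Y \<in> borel_measurable M" and Z: "Z \<in> borel_measurable M"
  shows "(\<forall>t. AE \<omega> in M. survival_indicator Y t \<omega> = cond_survival M Y Z t \<omega>)
    \<longleftrightarrow> as_function_of M Y Z"
proof -
  let ?F = "sigma_gen M Z"
  interpret finite_measure_subalgebra M ?F
    by unfold_locales (rule subalgebra_sigma_gen[OF Z])
  show ?thesis
  proof (intro iffI allI)
    assume *: "\<forall>t. AE \<omega> in M. survival_indicator Y t \<omega> = cond_survival M Y Z t \<omega>"
    show "as_function_of M Y Z"
    proof (rule as_function_of_if_orthants_determined)
      fix t
      have "cond_survival M Y Z t \<in> borel_measurable ?F"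
        by (simp add: cond_survival_def)
      then have "{\<omega> \<in> space ?F. cond_survival M Y Z t \<omega> = 1} \<in> sets ?F"
        by measurable
      then obtain A where A: "A \<in> sets borel"
          "{\<omega> \<in> space M. cond_survival M Y Z t \<omega> = 1} = Z -` A \<inter> space M"
        by (auto simp: sigma_gen_def sets_vimage_algebra2)
      have "AE \<omega> in M. t \<le> Y \<omega> \<longleftrightarrow> Z \<omega> \<in> A"
        using *[rule_format, of t] AE_space
      proof eventually_elim
        case (elim \<omega>)
        have "t \<le> Y \<omega> \<longleftrightarrow> cond_survival M Y Z t \<omega> = 1"
          using elim(1) by (auto simp: survival_indicator_eq split: if_splits)
        also have "\<dots> \<longleftrightarrow> Z \<omega> \<in> A" using A(2) elim(2) by blast
        finally show ?case .
      qed
      with A(1) show "\<exists>A\<in>sets borel. AE \<omega> in M. t \<le> Y \<omega> \<longleftrightarrow> Z \<omega> \<in> A" by blast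
    qed
  next
    fix t
    assume "as_function_of M Y Z"
    then obtain f where f: "f \<in> borel_measurable borel" and AE: "AE \<omega> in M. Y \<omega> = f (Z \<omega>)"
      by (auto simp: as_function_of_def)
    let ?g = "survival_indicator (\<lambda>\<omega>. f (Z \<omega>)) t"
    have "Z \<in> borel_measurable ?F"
      unfolding sigma_gen_def by (rule measurable_vimage_algebra1) auto
    then have gF: "?g \<in> borel_measurable ?F"
      using f by (intro survival_indicator_measurable) (rule measurable_compose)
    have gM: "(\<lambda>\<omega>. f (Z \<omega>)) \<in> borel_measurable M"
      using Z f by (rule measurable_compose)
    have AE_g: "AE \<omega> in M. survival_indicator Y t \<omega> = ?g \<omega>"
      using AE by eventually_elim (simp add: survival_indicator_eq)
    have "AE \<omega> in M. cond_survival M Y Z t \<omega> = real_cond_exp M ?F ?g \<omega>"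
      unfolding cond_survival_def
      using AE_g by (rule real_cond_exp_cong) (use gM in measurable)
    moreover have "AE \<omega> in M. real_cond_exp M ?F ?g \<omega> = ?g \<omega>"
      using survival_indicator_integrable[OF gM] gF by (rule real_cond_exp_F_meas)
    ultimately show "AE \<omega> in M. survival_indicator Y t \<omega> = cond_survival M Y Z t \<omega>"
      using AE_g by eventually_elim simp
  qed
qed

section \<open>Range and extreme values of the coefficient\<close>

theorem theorem1:
  fixes M :: "'a measure"
    and Y :: "'a \<Rightarrow> real ^ 'n"
    and Z :: "'a \<Rightarrow> real ^ 'm"
  assumes "prob_space M"
    and "Y \<in> borel_measurable M"
    and "Z \<in> borel_measurable M"
    and "\<not> as_constant M Y"
  shows "T_AC M Y Z \<in> {0..1} \<and>
         (T_AC M Y Z = 0 \<longleftrightarrow> independent_rvs M Y Z) \<and>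
         (T_AC M Y Z = 1 \<longleftrightarrow> as_function_of M Y Z)"
proof -
  interpret prob_space M by fact
  note Y = assms(2) and Z = assms(3)
  let ?F = "sigma_gen M Z"
  interpret finite_measure_subalgebra M ?F
    by unfold_locales (rule subalgebra_sigma_gen[OF Z])
  define D where "D y = variance (survival_indicator Y y)" for y
  define N where "N y = variance (cond_survival M Y Z y)" for y
  have ind: "integrable M (survival_indicator Y y)" for y
    using Y by (rule survival_indicator_integrable)
  have ind_le_1: "AE \<omega> in M. \<bar>survival_indicator Y y \<omega>\<bar> \<le> 1" for y
    by (simp add: survival_indicator_eq)
  have D_dom: "dominated_by_survival M Y D"
    unfolding D_def using Y
  proof (rule dominated_by_survival_variance)
    show "survival_indicator Y y \<in> borel_measurable M" for y
      using Y by (rule survival_indicator_measurable)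
    show "AE \<omega> in M. survival_indicator Y t \<omega> \<le> survival_indicator Y s \<omega>" if "s \<le> t" for s t
      using that by (auto simp: survival_indicator_eq)
    show "expectation (survival_indicator Y y) = survival M Y y" for y
      using Y by (rule expectation_survival_indicator)
  qed (auto simp: survival_indicator_eq)
  have N_dom: "dominated_by_survival M Y N"
    unfolding N_def cond_survival_def using Y
  proof (rule dominated_by_survival_variance)
    show "AE \<omega> in M. 0 \<le> real_cond_exp M ?F (survival_indicator Y y) \<omega>" for y
      by (rule real_cond_exp_ge_c[OF ind]) (auto simp: survival_indicator_eq)
    show "AE \<omega> in M. real_cond_exp M ?F (survival_indicator Y y) \<omega> \<le> 1" for y
      by (rule real_cond_exp_le_c[OF ind]) (auto simp: survival_indicator_eq)
    show "AE \<omega> in M. real_cond_exp M ?F (survival_indicator Y t) \<omega>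
        \<le> real_cond_exp M ?F (survival_indicator Y s) \<omega>" if "s \<le> t" for s t
      using that by (intro real_cond_exp_mono ind) (auto simp: survival_indicator_eq)
    show "expectation (real_cond_exp M ?F (survival_indicator Y y)) = survival M Y y" for y
      using real_cond_exp_int(2)[OF ind] Y by (simp add: expectation_survival_indicator)
  qed simp
  have DN: "D y - N y = expectation (\<lambda>\<omega>. (survival_indicator Y y \<omega> - cond_survival M Y Z y \<omega>)\<^sup>2)"
    "D y = N y \<longleftrightarrow> (AE \<omega> in M. survival_indicator Y y \<omega> = cond_survival M Y Z y \<omega>)" for y
    unfolding D_def N_def cond_survival_def
    using variance_minus_variance_cond_exp[OF subalg survival_indicator_measurable[OF Y, of y]]
      variance_eq_variance_cond_exp_iff[OF subalg survival_indicator_measurable[OF Y, of y]]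
    by (auto simp: survival_indicator_eq)
  have N_nonneg: "N y \<ge> 0" and D_nonneg: "D y \<ge> 0" and DN_nonneg: "D y - N y \<ge> 0" for y
    unfolding DN(1) by (auto simp: N_def D_def)
  let ?ID = "LINT y|prod_marginals M Y. D y" and ?IN = "LINT y|prod_marginals M Y. N y"
  have T: "T_AC M Y Z = ?IN / ?ID"
    by (simp add: T_AC_def N_def D_def)
  have N_int: "integrable (prod_marginals M Y) N" and D_int: "integrable (prod_marginals M Y) D"
    using dominated_by_survival_integrable[OF Y] N_dom D_dom by auto
  \<comment> \<open>If the denominator vanished, then all events \<open>{t \<le> Y}\<close> would have probability \<open>0\<close> or \<open>1\<close>.\<close>
  have "?ID \<noteq> 0"
  proof
    assume "?ID = 0"
    then have "D t = 0" for t
      using dominated_by_survival_integral_eq_0_iff[OF Y D_dom D_nonneg] by blast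
    then have "AE \<omega> in M. survival_indicator Y t \<omega> = expectation (survival_indicator Y t)" for t
      unfolding D_def
      using variance_eq_0_iff[OF survival_indicator_measurable[OF Y] ind_le_1] by blast
    then have "as_constant M Y"
      by (rule as_constant_if_survival_indicators_constant)
    with assms(4) show False by contradiction
  qed
  moreover have "0 \<le> ?ID" using D_nonneg by (intro integral_nonneg_AE) auto
  ultimately have ID_pos: "0 < ?ID" by simp
  have "0 \<le> ?IN" using N_nonneg by (intro integral_nonneg_AE) auto
  moreover have "?IN \<le> ?ID"
    using N_int D_int DN_nonneg by (intro integral_mono) auto
  ultimately have "T_AC M Y Z \<in> {0..1}"
    using ID_pos by (simp add: T)
  moreover have "T_AC M Y Z = 0 \<longleftrightarrow> independent_rvs M Y Z"
  proof -
    have "T_AC M Y Z = 0 \<longleftrightarrow> ?IN = 0" using ID_pos by (simp add: T)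
    also have "\<dots> \<longleftrightarrow> (\<forall>t. N t = 0)"
      using Y N_dom N_nonneg by (rule dominated_by_survival_integral_eq_0_iff)
    finally show ?thesis
      unfolding N_def variance_cond_survival_eq_0_iff[OF Y Z] .
  qed
  moreover have "T_AC M Y Z = 1 \<longleftrightarrow> as_function_of M Y Z"
  proof -
    have "T_AC M Y Z = 1 \<longleftrightarrow> (LINT y|prod_marginals M Y. D y - N y) = 0"
      using ID_pos D_int N_int by (auto simp: T)
    also have "\<dots> \<longleftrightarrow> (\<forall>t. D t - N t = 0)"
      using Y dominated_by_survival_diff[OF D_dom N_dom] DN_nonneg
      by (rule dominated_by_survival_integral_eq_0_iff)
    also have "\<dots> \<longleftrightarrow> as_function_of M Y Z"
      by (simp add: DN(2) survival_indicator_eq_cond_survival_iff[OF Y Z])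
    finally show ?thesis .
  qed
  ultimately show ?thesis by blast
qed

end
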